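(* Let $a,b,n$ be positive integers. Then the Whitney polynomial of the $(a,b)$-Catalan matroid satisfies $$W_{C_n^{a,b}}(x)=\sum_{\lambda\vdash n}\frac1{z_\lambda}\,W_{U_\lambda^{a,b}}(x),$$ where the sum is over all partitions $\lambda=(\lambda_1,\dots,\lambda_k)$ of $n$ and $W_{U_\lambda^{a,b}}(x)=\prod_{j=1}^k W_{U_{\lambda_j}^{a,b}}(x)$.
   Context: For $m\ge1$, $U_m^{a,b}=U_{mb,m(a+b)}$ is the uniform matroid of rank $mb$ on $m(a+b)$ elements. For $S\subseteq[N]$, the Schubert matroid $\mathrm{SM}_N(S)$ is the matroid on $[N]$ whose bases are the $T\subseteq[N]$ with $|T|=|S|$ such that for every $i$ the $i$-th smallest element of $T$ is at most the $i$-th smallest element of $S$. The $(a,b)$-Catalan matroid $C_n^{a,b}$ is $\mathrm{SM}_{n(a+b)}(S)$ where $S$ has indicator vector $(0^a,1^b,\dots,0^a,1^b)$ ($n$ blocks of $a$ zeros followed by $b$ ones). For a partition $\lambda$ of $n$ in which $i$ appears $\alpha_i$ times, $z_\lambda=\prod_i i^{\alpha_i}\alpha_i!$. The Whitney polynomial of a matroid $M$ of rank $k$ is $W_M(x)=\sum_{i=0}^k W_i x^i$, where $W_i$ is the number of flats of $M$ of rank $i$. *)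

theory Defs
  imports "HOL-Computational_Algebra.Polynomial" "HOL-Library.Multiset"
begin

section \<open>Matroids given by their bases\<close>

record 'a basis_system =
  ground :: "'a set"
  bases :: "'a set set"

definition is_matroid :: "'a basis_system \<Rightarrow> bool" where
  "is_matroid M \<longleftrightarrow>
     finite (ground M) \<and> bases M \<subseteq> Pow (ground M) \<and> bases M \<noteq> {} \<and>
     (\<forall>B\<^sub>1\<in>bases M. \<forall>B\<^sub>2\<in>bases M. \<forall>x\<in>B\<^sub>1 - B\<^sub>2. \<exists>y\<in>B\<^sub>2 - B\<^sub>1. insert y (B\<^sub>1 - {x}) \<in> bases M)"

definition indep :: "'a basis_system \<Rightarrow> 'a set \<Rightarrow> bool" where
  "indep M I \<longleftrightarrow> (\<exists>B\<in>bases M. I \<subseteq> B)"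

definition rank_of :: "'a basis_system \<Rightarrow> 'a set \<Rightarrow> nat" where
  "rank_of M X = Max (card ` {I. I \<subseteq> X \<and> indep M I})"

definition matroid_rank :: "'a basis_system \<Rightarrow> nat" where
  "matroid_rank M = rank_of M (ground M)"

definition is_flat :: "'a basis_system \<Rightarrow> 'a set \<Rightarrow> bool" where
  "is_flat M F \<longleftrightarrow>
     F \<subseteq> ground M \<and> (\<forall>e\<in>ground M - F. rank_of M F < rank_of M (insert e F))"

definition whitney_number :: "'a basis_system \<Rightarrow> nat \<Rightarrow> nat" where
  "whitney_number M i = card {F. is_flat M F \<and> rank_of M F = i}"

definition whitney_poly :: "'a basis_system \<Rightarrow> rat poly" where
  "whitney_poly M = (\<Sum>i\<le>matroid_rank M. monom (of_nat (whitney_number M i)) i)"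

section \<open>Uniform, Schubert and Catalan matroids\<close>

text \<open>\<open>uniform k N\<close> is a matroid for \<open>k \<le> N\<close>, and \<open>schubert N S\<close> for \<open>S \<subseteq> {1..N}\<close>;
  see the lemmas \<open>is_matroid_uniform\<close> and \<open>is_matroid_schubert\<close>.\<close>

definition uniform :: "nat \<Rightarrow> nat \<Rightarrow> nat basis_system" where
  "uniform k N = \<lparr>ground = {1..N}, bases = {B. B \<subseteq> {1..N} \<and> card B = k}\<rparr>"

definition schubert :: "nat \<Rightarrow> nat set \<Rightarrow> nat basis_system" where
  "schubert N S = \<lparr>ground = {1..N},
     bases = {T. T \<subseteq> {1..N} \<and> card T = card S \<and>
                 (\<forall>i<card S. sorted_list_of_set T ! i \<le> sorted_list_of_set S ! i)}\<rparr>"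

definition uniform_ab :: "nat \<Rightarrow> nat \<Rightarrow> nat \<Rightarrow> nat basis_system" where
  "uniform_ab a b m = uniform (m * b) (m * (a + b))"

definition catalan_vector :: "nat \<Rightarrow> nat \<Rightarrow> nat \<Rightarrow> nat list" where
  "catalan_vector a b n = concat (replicate n (replicate a 0 @ replicate b 1))"

text \<open>Lists are indexed from 0, the ground set from 1.\<close>

definition catalan_set :: "nat \<Rightarrow> nat \<Rightarrow> nat \<Rightarrow> nat set" where
  "catalan_set a b n = {p \<in> {1..n * (a + b)}. catalan_vector a b n ! (p - 1) = 1}"

definition catalan :: "nat \<Rightarrow> nat \<Rightarrow> nat \<Rightarrow> nat basis_system" where
  "catalan a b n = schubert (n * (a + b)) (catalan_set a b n)"

section \<open>Integer partitions\<close>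

text \<open>A partition is the multiset of its (positive) parts, so that
  \<open>count \<mu> i\<close> is the multiplicity \<open>\<alpha>\<^sub>i\<close> of the part \<open>i\<close>.\<close>

definition partitions :: "nat \<Rightarrow> nat multiset set" where
  "partitions n = {\<mu>. 0 \<notin># \<mu> \<and> sum_mset \<mu> = n}"

definition z_number :: "nat multiset \<Rightarrow> nat" where
  "z_number \<mu> = (\<Prod>i\<in>set_mset \<mu>. i ^ count \<mu> i * fact (count \<mu> i))"

section \<open>Well-definedness\<close>

lemma size_le_sum_mset: "0 \<notin># (\<mu>::nat multiset) \<Longrightarrow> size \<mu> \<le> sum_mset \<mu>"
  by (induction \<mu>) (auto simp: Suc_le_eq)

lemma finite_partitions: "finite (partitions n)"
proof (rule finite_subset)
  show "partitions n \<subseteq> mset ` {xs. set xs \<subseteq> {0..n} \<and> length xs \<le> n}"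
  proof
    fix \<mu> assume l: "\<mu> \<in> partitions n"
    obtain xs where xs: "\<mu> = mset xs" by (metis ex_mset)
    have "set xs \<subseteq> {0..n}"
      using l unfolding partitions_def xs by (auto simp: sum_mset_sum_list member_le_sum_list)
    moreover have "length xs \<le> n"
      using l size_le_sum_mset[of \<mu>] unfolding partitions_def xs by simp
    ultimately show "\<mu> \<in> mset ` {xs. set xs \<subseteq> {0..n} \<and> length xs \<le> n}" using xs by blast
  qed
  show "finite (mset ` {xs. set xs \<subseteq> {0..n} \<and> length xs \<le> n})"
    by (intro finite_imageI finite_lists_length_le) simp
qed

lemma is_matroid_uniform:
  assumes "k \<le> N" shows "is_matroid (uniform k N)"
proof -
  have "\<exists>y\<in>B - A. insert y (A - {x}) \<subseteq> {1..N} \<and> card (insert y (A - {x})) = k"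
    if A: "A \<subseteq> {1..N}" "card A = k" and B: "B \<subseteq> {1..N}" "card B = k" and x: "x \<in> A" "x \<notin> B"
    for A B :: "nat set" and x
  proof -
    have fin: "finite A" "finite B" using A B finite_subset by blast+
    have "\<not> B \<subseteq> A" using x A B fin by (metis card_subset_eq)
    then obtain y where y: "y \<in> B" "y \<notin> A" by blast
    moreover have "card (insert y (A - {x})) = k"
      using x y fin A(2) card_Suc_Diff1[of A x] by simp
    ultimately show ?thesis using A B by blast
  qed
  moreover have "\<exists>B. B \<subseteq> {1..N} \<and> card B = k"
    using assms by (intro exI[of _ "{1..k}"]) auto
  ultimately show ?thesis unfolding is_matroid_def uniform_def by auto
qed

lemma nth_sorted_le_iff:
  fixes T :: "nat set"
  assumes "finite T" "i < card T"
  shows "sorted_list_of_set T ! i \<le> j \<longleftrightarrow> i < card (T \<inter> {..j})"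
proof -
  define xs where "xs = sorted_list_of_set T"
  have xs: "sorted xs" "distinct xs" "set xs = T" "length xs = card T"
    using assms by (auto simp: xs_def)
  have inj: "inj_on (\<lambda>k. xs ! k) {..<card T}"
    using xs by (auto simp: inj_on_def nth_eq_iff_index_eq)
  have eq: "T \<inter> {..j} = (\<lambda>k. xs ! k) ` {k. k < card T \<and> xs ! k \<le> j}"
    using xs by (auto simp: image_def in_set_conv_nth)
  have card: "card (T \<inter> {..j}) = card {k. k < card T \<and> xs ! k \<le> j}"
    unfolding eq by (rule card_image) (use inj in \<open>auto simp: inj_on_def\<close>)
  show ?thesis unfolding xs_def[symmetric]
  proof
    assume le: "xs ! i \<le> j"
    have "{..i} \<subseteq> {k. k < card T \<and> xs ! k \<le> j}"
      using le assms xs by (auto intro: order_trans[OF sorted_nth_mono[OF xs(1)]])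
    then have "card {..i} \<le> card (T \<inter> {..j})"
      unfolding card by (intro card_mono) auto
    then show "i < card (T \<inter> {..j})" by simp
  next
    assume lt: "i < card (T \<inter> {..j})"
    show "xs ! i \<le> j"
    proof (rule ccontr)
      assume n: "\<not> xs ! i \<le> j"
      have "{k. k < card T \<and> xs ! k \<le> j} \<subseteq> {..<i}"
      proof (clarsimp, rule ccontr)
        fix k assume k: "k < card T" "xs ! k \<le> j" "\<not> k < i"
        then have "xs ! i \<le> xs ! k" using xs by (intro sorted_nth_mono) auto
        then show False using k n by simp
      qed
      then have "card (T \<inter> {..j}) \<le> card {..<i}"
        unfolding card by (intro card_mono) auto
      then show False using lt by simp
    qed
  qed
qed

lemma schubert_basis_iff:
  assumes "finite T" "finite S" "card T = card S"
  shows "(\<forall>i<card S. sorted_list_of_set T ! i \<le> sorted_list_of_set S ! i) \<longleftrightarrow>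
         (\<forall>j. card (S \<inter> {..j}) \<le> card (T \<inter> {..j :: nat}))"
proof (intro iffI allI impI)
  fix j assume L: "\<forall>i<card S. sorted_list_of_set T ! i \<le> sorted_list_of_set S ! i"
  show "card (S \<inter> {..j}) \<le> card (T \<inter> {..j})"
  proof (cases "card (S \<inter> {..j})")
    case (Suc c)
    have "card (S \<inter> {..j}) \<le> card S" using assms by (intro card_mono) auto
    then have c: "c < card S" using Suc by simp
    then have "sorted_list_of_set S ! c \<le> j" using nth_sorted_le_iff[of S c j] assms Suc by simp
    then have "sorted_list_of_set T ! c \<le> j" using L c by (meson order_trans)
    then show ?thesis using nth_sorted_le_iff[of T c j] assms Suc c by simp
  qed simp
next
  fix i assume R: "\<forall>j. card (S \<inter> {..j}) \<le> card (T \<inter> {..j})" and i: "i < card S"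
  show "sorted_list_of_set T ! i \<le> sorted_list_of_set S ! i"
    using nth_sorted_le_iff[of S i "sorted_list_of_set S ! i"]
      nth_sorted_le_iff[of T i "sorted_list_of_set S ! i"] assms i R
    by (metis order_refl order_less_le_trans)
qed

lemma is_matroid_schubert:
  assumes "S \<subseteq> {1..N}" shows "is_matroid (schubert N S)"
proof -
  have finS: "finite S" using assms finite_subset by blast
  define \<B> where "\<B> = {T. T \<subseteq> {1..N} \<and> card T = card S \<and>
    (\<forall>j. card (S \<inter> {..j}) \<le> card (T \<inter> {..j}))}"
  have "finite T" if "T \<subseteq> {1..N}" for T
    using that finite_subset by blast
  then have bases: "bases (schubert N S) = \<B>"
    unfolding schubert_def \<B>_def basis_system.simps
    using schubert_basis_iff[OF _ finS] by blast
  have "\<exists>y\<in>B - A. insert y (A - {x}) \<in> \<B>"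
    if A: "A \<in> \<B>" and B: "B \<in> \<B>" and x: "x \<in> A" "x \<notin> B" for A B x
  proof -
    have fin: "finite A" "finite B" using A B finite_subset unfolding \<B>_def by blast+
    have cAB: "card A = card B" using A B by (simp add: \<B>_def)
    then have "\<not> B \<subseteq> A" using x fin by (metis card_subset_eq)
    then have ne: "B - A \<noteq> {}" by blast
    define y where "y = Min (B - A)"
    have y: "y \<in> B" "y \<notin> A" and ymin: "\<And>z. z \<in> B - A \<Longrightarrow> y \<le> z"
      using Min_in[of "B - A"] ne fin unfolding y_def by auto
    let ?C = "insert y (A - {x})"
    have cC: "card ?C = card S"
      using x y fin A card_Suc_Diff1[of A x] by (simp add: \<B>_def)
    have "card (S \<inter> {..j}) \<le> card (?C \<inter> {..j})" for j
    proof (cases "x \<le> j \<and> j < y")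
      case True
      have "B \<inter> {..j} \<subseteq> ?C \<inter> {..j}"
        using True ymin x by fastforce
      then have "card (B \<inter> {..j}) \<le> card (?C \<inter> {..j})"
        using fin by (intro card_mono) auto
      then show ?thesis using B unfolding \<B>_def by (auto intro: order_trans)
    next
      case False
      have "card (A \<inter> {..j}) \<le> card (?C \<inter> {..j})"
      proof (cases "x \<le> j")
        case True
        then have "y \<le> j" using False by simp
        then have "?C \<inter> {..j} = insert y (A \<inter> {..j} - {x})" by auto
        then show ?thesis
          using True x y fin card_Suc_Diff1[of "A \<inter> {..j}" x] by simp
      next
        case False
        then show ?thesis using fin by (intro card_mono) auto
      qed
      then show ?thesis using A unfolding \<B>_def by (auto intro: order_trans)
    qed
    then have "?C \<in> \<B>" using A B y cC unfolding \<B>_def by auto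
    then show ?thesis using y by blast
  qed
  moreover have "S \<in> \<B>" using assms by (simp add: \<B>_def)
  moreover have "\<B> \<subseteq> Pow {1..N}" by (auto simp: \<B>_def)
  moreover have "ground (schubert N S) = {1..N}" by (simp add: schubert_def)
  ultimately show ?thesis unfolding is_matroid_def bases by auto
qed

corollary is_matroid_uniform_ab: "is_matroid (uniform_ab a b m)"
  unfolding uniform_ab_def by (intro is_matroid_uniform) simp

corollary is_matroid_catalan: "is_matroid (catalan a b n)"
  unfolding catalan_def by (intro is_matroid_schubert) (auto simp: catalan_set_def)

end

theory Submission
  imports Defs "HOL-Computational_Algebra.Formal_Power_Series"
begin

text \<open>
  With \<open>W(z) = \<Sum>\<^sub>n W\<^bsub>C\<^sub>n\<^esub>(x) z\<^sup>n\<close>, the claim says \<open>z W' = W \<cdot> \<Sum>\<^sub>m W\<^bsub>U\<^sub>m\<^esub>(x) z\<^sup>m\<close>.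
  The rank of \<open>F\<close> in the Catalan matroid is the minimum over \<open>j \<le> n\<close> of
  \<open>|F \<inter> [j(a+b)]| + (n-j)b\<close>, and \<open>F\<close> is a flat iff it contains everything after block \<open>k\<close>, where
  \<open>k\<close> is the first minimizer. Hence \<open>W = A \<cdot> \<Sum>\<^sub>k (x\<^sup>b z)\<^sup>k\<close>, where \<open>A\<close> counts the subsets of \<open>[k(a+b)]\<close> for
  which \<open>k\<close> is the unique minimizer. Cutting arbitrary subsets at the first minimizer gives
  \<open>1 / (1 - (1+x)\<^bsup>a+b\<^esup> z) = A \<cdot> N\<close>; in the logarithmic derivative of this, \<open>A\<close> accounts for the monomials
  \<open>x\<^sup>i z\<^sup>m\<close> with \<open>i < mb\<close> and \<open>N\<close> for those with \<open>i \<ge> mb\<close>, as in Spitzer's identity.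
\<close>

section \<open>Partition sums and power sum recursions\<close>

text \<open>Only the factor of \<open>m\<close> changes: its multiplicity goes up by one, which
  contributes one more \<open>m\<close> and one more factor of the factorial. Consequently
  \<open>m * count / z_number\<close> of the larger partition equals \<open>1 / z_number\<close> of
  the smaller one.\<close>

lemma z_number_add_mset:
  "z_number (add_mset m \<mu>) = m * count (add_mset m \<mu>) m * z_number \<mu>"
proof -
  let ?f = "\<lambda>\<mu> i. i ^ count \<mu> i * fact (count \<mu> i) :: nat"
  \<comment> \<open>A part of multiplicity 0 has factor 1, so both products can be taken over one
    common index set, whether or not \<open>m\<close> already occurs in
    \<open>\<mu>\<close>.\<close>
  have z: "z_number \<nu> = (\<Prod>i\<in>insert m (set_mset \<mu>). ?f \<nu> i)" if "set_mset \<nu> \<subseteq> insert m (set_mset \<mu>)" for \<nu>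
    unfolding z_number_def
    by (rule prod.mono_neutral_left) (use that in \<open>auto simp: not_in_iff\<close>)
  have "z_number (add_mset m \<mu>) = (\<Prod>i\<in>insert m (set_mset \<mu>). ?f (add_mset m \<mu>) i)"
    by (rule z) auto
  also have "\<dots> = (\<Prod>i\<in>insert m (set_mset \<mu>). (if i = m then m * Suc (count \<mu> m) else 1) * ?f \<mu> i)"
    by (rule prod.cong) (auto simp: algebra_simps)
  also have "\<dots> = (\<Prod>i\<in>insert m (set_mset \<mu>). if i = m then m * Suc (count \<mu> m) else 1) *
      (\<Prod>i\<in>insert m (set_mset \<mu>). ?f \<mu> i)"
    by (rule prod.distrib)
  also have "(\<Prod>i\<in>insert m (set_mset \<mu>). if i = m then m * Suc (count \<mu> m) else 1) = m * Suc (count \<mu> m)"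
    by (subst prod.delta) auto
  also have "(\<Prod>i\<in>insert m (set_mset \<mu>). ?f \<mu> i) = z_number \<mu>"
    by (rule z[symmetric]) auto
  finally show ?thesis by simp
qed

lemma sum_mset_multiplicity:
  fixes \<mu> :: "nat multiset"
  assumes "finite A" "set_mset \<mu> \<subseteq> A"
  shows "(\<Sum>m\<in>A. m * count \<mu> m) = sum_mset \<mu>"
  using assms(2)
proof (induction \<mu>)
  case (add k \<mu>)
  have "(\<Sum>m\<in>A. m * count (add_mset k \<mu>) m) = (\<Sum>m\<in>A. m * count \<mu> m + (if m = k then k else 0))"
    by (intro sum.cong) auto
  then show ?case using add assms(1) by (simp add: sum.distrib)
qed simp

text \<open>This is Newton's identity relating complete homogeneous and power sums. Pairs of a
  partition of \<open>n\<close> and one of its distinct parts \<open>m\<close> are counted with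
  weight \<open>m * count \<mu> m / z_number \<mu>\<close>. Summing over \<open>m\<close> first
  yields the factor \<open>n\<close>; deleting one copy of \<open>m\<close> first yields the
  convolution.\<close>

lemma partition_sum_recursion:
  fixes p :: "nat \<Rightarrow> rat poly" and n :: nat
  defines "h \<equiv> \<lambda>n. \<Sum>\<mu>\<in>partitions n. smult (1 / of_nat (z_number \<mu>)) (\<Prod>m\<in>#\<mu>. p m)"
  shows "of_nat n * h n = (\<Sum>m\<in>{1..n}. p m * h (n - m))"
proof -
  let ?w = "\<lambda>\<mu>. \<Prod>m\<in>#\<mu>. p m"
  let ?t = "\<lambda>\<mu> m. smult (of_nat (m * count \<mu> m) / of_nat (z_number \<mu>)) (?w \<mu>)"
  have "(\<Sum>m\<in>{1..n}. p m * h (n - m)) =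
      (\<Sum>m\<in>{1..n}. \<Sum>\<mu>\<in>partitions (n - m). ?t (add_mset m \<mu>) m)"
  proof (intro sum.cong refl)
    fix m assume m: "m \<in> {1..n}"
    show "p m * h (n - m) = (\<Sum>\<mu>\<in>partitions (n - m). ?t (add_mset m \<mu>) m)"
      unfolding h_def sum_distrib_left
    proof (intro sum.cong refl)
      fix \<mu>
      have "1 / of_nat (z_number \<mu>) =
          (of_nat (m * count (add_mset m \<mu>) m) / of_nat (z_number (add_mset m \<mu>)) :: rat)"
        using m by (simp add: z_number_add_mset del: count_add_mset of_nat_add)
      then show "p m * smult (1 / of_nat (z_number \<mu>)) (?w \<mu>) = ?t (add_mset m \<mu>) m"
        by (simp only: mult_smult_right image_mset_add_mset prod_mset.add_mset)
    qed
  qed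
  also have "\<dots> = (\<Sum>(m, \<mu>)\<in>Sigma {1..n} (\<lambda>m. partitions (n - m)). ?t (add_mset m \<mu>) m)"
    by (subst sum.Sigma) (auto simp: finite_partitions)
  also have "\<dots> = (\<Sum>(\<mu>, m)\<in>Sigma (partitions n) set_mset. ?t \<mu> m)"
  \<comment> \<open>A partition with a distinguished part value \<open>m\<close> corresponds to
    \<open>m\<close> together with the partition of \<open>n - m\<close> left after removing one
    copy of \<open>m\<close>.\<close>
  proof (rule sum.reindex_bij_witness[where i = "\<lambda>(\<mu>, m). (m, \<mu> - {#m#})"
          and j = "\<lambda>(m, \<mu>). (add_mset m \<mu>, m)"])
    fix x assume "x \<in> Sigma (partitions n) set_mset"
    then obtain m \<mu> where x: "x = (add_mset m \<mu>, m)" "add_mset m \<mu> \<in> partitions n"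
      by (metis SigmaE insert_DiffM)
    then have "1 \<le> m" "m \<le> n" "\<mu> \<in> partitions (n - m)"
      by (auto simp: partitions_def Suc_le_eq intro: gr0I)
    with x show "(case case x of (\<mu>, m) \<Rightarrow> (m, \<mu> - {#m#}) of (m, \<mu>) \<Rightarrow> (add_mset m \<mu>, m)) = x"
      "(case x of (\<mu>, m) \<Rightarrow> (m, \<mu> - {#m#})) \<in> Sigma {1..n} (\<lambda>m. partitions (n - m))"
      by auto
  qed (auto simp: partitions_def distrib_left)
  also have "\<dots> = (\<Sum>\<mu>\<in>partitions n. \<Sum>m\<in>set_mset \<mu>. ?t \<mu> m)"
    by (subst sum.Sigma) (auto simp: finite_partitions)
  also have "\<dots> = (\<Sum>\<mu>\<in>partitions n. of_nat n * smult (1 / of_nat (z_number \<mu>)) (?w \<mu>))"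
  proof (intro sum.cong refl)
    fix \<mu> assume \<mu>: "\<mu> \<in> partitions n"
    have "(\<Sum>m\<in>set_mset \<mu>. ?t \<mu> m) =
        smult (of_nat (\<Sum>m\<in>set_mset \<mu>. m * count \<mu> m) / of_nat (z_number \<mu>)) (?w \<mu>)"
      by (simp add: smult_sum sum_divide_distrib)
    also have "(\<Sum>m\<in>set_mset \<mu>. m * count \<mu> m) = n"
      using \<mu> by (simp add: sum_mset_multiplicity partitions_def)
    finally show "(\<Sum>m\<in>set_mset \<mu>. ?t \<mu> m) = of_nat n * smult (1 / of_nat (z_number \<mu>)) (?w \<mu>)"
      by (simp add: of_nat_poly)
  qed
  finally show ?thesis by (simp add: h_def sum_distrib_left)
qed

text \<open>The recursion expresses \<open>n\<close> times the \<open>n\<close>-th term by earlier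
  terms, and a nonzero \<open>n\<close> can be cancelled, so the initial value determines the whole
  sequence. The claim about Whitney polynomials thus reduces to this recursion.\<close>

lemma partition_sum_unique:
  fixes c p :: "nat \<Rightarrow> rat poly"
  assumes c0: "c 0 = 1" and c: "\<And>n. of_nat n * c n = (\<Sum>m\<in>{1..n}. p m * c (n - m))"
  shows "c n = (\<Sum>\<mu>\<in>partitions n. smult (1 / of_nat (z_number \<mu>)) (\<Prod>m\<in>#\<mu>. p m))"
proof (induction n rule: less_induct)
  case (less n)
  show ?case
  proof (cases "n = 0")
    case True
    have "\<mu> = {#}" if "0 \<notin># \<mu>" "sum_mset \<mu> = 0" for \<mu> :: "nat multiset"
      using size_le_sum_mset[OF that(1)] that(2) by simp
    then have "partitions 0 = {{#}}" by (auto simp: partitions_def)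
    then show ?thesis using True c0 by (simp add: z_number_def)
  next
    case False
    have "of_nat n * c n = of_nat n * (\<Sum>\<mu>\<in>partitions n. smult (1 / of_nat (z_number \<mu>)) (\<Prod>m\<in>#\<mu>. p m))"
      unfolding c partition_sum_recursion by (intro sum.cong refl) (simp add: less)
    then show ?thesis using False by simp
  qed
qed

text \<open>Once all coefficients of \<open>D\<close> and \<open>E\<close> below \<open>n\<close>
  vanish, the \<open>n\<close>-th coefficients of the two products are just those of
  \<open>D\<close> and \<open>E\<close>, because \<open>N\<close> and \<open>A\<close> start with 1.
  So these coefficients agree, yet one lives in degrees below \<open>n * b\<close> and the other in
  degrees from \<open>n * b\<close> on; both are 0.\<close>

lemma disjoint_supports_zero:
  fixes A N D E :: "rat poly fps" and b :: nat
  assumes eq: "N * D = A * E" and A0: "fps_nth A 0 = 1" and N0: "fps_nth N 0 = 1"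
    and D: "\<And>n i. n * b \<le> i \<Longrightarrow> coeff (fps_nth D n) i = 0"
    and E: "\<And>n i. i < n * b \<Longrightarrow> coeff (fps_nth E n) i = 0"
  shows "D = 0"
proof -
  have "fps_nth D n = 0 \<and> fps_nth E n = 0" for n
  proof (induction n rule: less_induct)
    case (less n)
    have top: "fps_nth (F * G) n = fps_nth G n"
      if "fps_nth F 0 = 1" "\<And>k. k < n \<Longrightarrow> fps_nth G k = 0" for F G :: "rat poly fps"
    proof -
      have "fps_nth (F * G) n = (\<Sum>i=0..n. if i = 0 then fps_nth G n else 0)"
        unfolding fps_mult_nth using that by (intro sum.cong) auto
      then show ?thesis by simp
    qed
    have "fps_nth D n = fps_nth E n"
      using top[of N D] top[of A E] less A0 N0 eq by auto
    moreover have "fps_nth D n = 0"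
      by (rule poly_eqI) (metis D E calculation coeff_0 not_le)
    ultimately show ?case by simp
  qed
  then show ?thesis by (simp add: fps_eq_iff)
qed

section \<open>Ranks and flats\<close>

lemma rank_of_eqI:
  assumes fin: "finite X"
    and I: "I \<subseteq> X" "indep M I" "card I = r"
    and le: "\<And>J. J \<subseteq> X \<Longrightarrow> indep M J \<Longrightarrow> card J \<le> r"
  shows "rank_of M X = r"
  unfolding rank_of_def
proof (rule Max_eqI)
  show "finite (card ` {I. I \<subseteq> X \<and> indep M I})"
    using fin by (auto intro: finite_subset[of _ "Pow X"])
qed (use I le in auto)

text \<open>Flats are grouped by rank. Monotonicity of the rank ensures that the cutoff at
  \<open>matroid_rank M\<close> loses no flat.\<close>

lemma whitney_poly_eq_sum_flats:
  assumes "is_matroid M"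
  shows "whitney_poly M = (\<Sum>F | is_flat M F. monom 1 (rank_of M F))"
proof -
  let ?F = "{F. is_flat M F}"
  have fin: "finite (ground M)" and ne: "bases M \<noteq> {}"
    using assms by (auto simp: is_matroid_def)
  have finF: "finite ?F"
    using fin by (auto simp: is_flat_def intro: finite_subset[of _ "Pow (ground M)"])
  have "rank_of M F \<le> matroid_rank M" if "is_flat M F" for F
    unfolding rank_of_def matroid_rank_def
  proof (rule Max_mono)
    show "card ` {I. I \<subseteq> F \<and> indep M I} \<noteq> {}"
      using ne by (auto simp: indep_def)
    show "finite (card ` {I. I \<subseteq> ground M \<and> indep M I})"
      using fin by (auto intro: finite_subset[of _ "Pow (ground M)"])
  qed (use that in \<open>auto simp: is_flat_def\<close>)
  then have "(\<Sum>F\<in>?F. monom (1::rat) (rank_of M F)) =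
      (\<Sum>i\<in>{..matroid_rank M}. \<Sum>F\<in>{F \<in> ?F. rank_of M F = i}. monom 1 (rank_of M F))"
    by (intro sum.group[symmetric]) (use finF in auto)
  also have "\<dots> = whitney_poly M"
    unfolding whitney_poly_def whitney_number_def
    by (intro sum.cong refl) (simp add: of_nat_poly smult_monom)
  finally show ?thesis ..
qed

section \<open>Flats of uniform matroids\<close>

lemma indep_uniform_iff:
  assumes "k \<le> N"
  shows "indep (uniform k N) I \<longleftrightarrow> I \<subseteq> {1..N} \<and> card I \<le> k"
proof
  assume "indep (uniform k N) I"
  then obtain B where "I \<subseteq> B" "B \<subseteq> {1..N}" "card B = k"
    by (auto simp: indep_def uniform_def)
  then show "I \<subseteq> {1..N} \<and> card I \<le> k"
    by (metis card_mono finite_atLeastAtMost finite_subset order_trans)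
next
  assume I: "I \<subseteq> {1..N} \<and> card I \<le> k"
  have "\<exists>B. I \<subseteq> B \<and> B \<subseteq> {1..N} \<and> card B = k"
    using I assms by (intro exists_subset_between) auto
  then show "indep (uniform k N) I"
    by (auto simp: indep_def uniform_def)
qed

lemma rank_of_uniform:
  assumes "k \<le> N" "X \<subseteq> {1..N}"
  shows "rank_of (uniform k N) X = min (card X) k"
proof -
  have fin: "finite X" using assms finite_subset by blast
  obtain I where "I \<subseteq> X" "card I = min (card X) k"
    by (meson min.cobounded1 obtain_subset_with_card_n)
  then show ?thesis
    using fin assms by (intro rank_of_eqI[of X I]) (auto simp: indep_uniform_iff intro: card_mono)
qed

lemma ground_uniform: "ground (uniform k N) = {1..N}"
  by (simp add: uniform_def)

lemma is_flat_uniform_iff: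
  assumes "k \<le> N"
  shows "is_flat (uniform k N) F \<longleftrightarrow> F \<subseteq> {1..N} \<and> (card F < k \<or> F = {1..N})"
proof -
  have "(\<forall>e\<in>{1..N} - F. min (card F) k < min (card (insert e F)) k) \<longleftrightarrow> card F < k \<or> F = {1..N}"
    if F: "F \<subseteq> {1..N}"
  proof -
    have fin: "finite F" using F finite_subset by blast
    have "(\<forall>e\<in>{1..N} - F. min (card F) k < min (card (insert e F)) k) \<longleftrightarrow>
        (\<forall>e\<in>{1..N} - F. card F < k)"
      using fin by (intro ball_cong) auto
    then show ?thesis using F by blast
  qed
  then show ?thesis
    using assms by (auto simp: is_flat_def rank_of_uniform ground_uniform)
qed

text \<open>The last summand is the ground set; all other flats have rank equal to their size. For
  \<open>k = m * b\<close> the two summands become the coefficients of the series \<open>B\<close>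
  and \<open>G\<close> in the final proof.\<close>

lemma whitney_poly_uniform:
  assumes "k \<le> N"
  shows "whitney_poly (uniform k N) =
    (\<Sum>F | F \<subseteq> {1..N} \<and> card F < k. monom 1 (card F)) + monom 1 k"
proof -
  have "{F. is_flat (uniform k N) F} = insert {1..N} {F. F \<subseteq> {1..N} \<and> card F < k}"
    by (auto simp: is_flat_uniform_iff[OF assms])
  moreover have "finite {F. F \<subseteq> {1..N} \<and> card F < k}"
    by (rule finite_subset[of _ "Pow {1..N}"]) auto
  ultimately show ?thesis
    using assms by (simp add: whitney_poly_eq_sum_flats is_matroid_uniform rank_of_uniform)
qed

section \<open>Independence and rank in Schubert matroids\<close>

lemma card_split_at:
  "finite X \<Longrightarrow> card X = card (X \<inter> {..j}) + card (X \<inter> {j<..})" for j :: nat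
  by (subst card_Un_disjoint[symmetric]) (auto intro!: arg_cong[of _ _ card])

text \<open>For sets of equal size, lower bounds on initial segments are upper bounds on tails. The
  tail form is inherited by subsets, so it can also describe independent sets.\<close>

lemma schubert_bases:
  assumes "S \<subseteq> {1..N}"
  shows "B \<in> bases (schubert N S) \<longleftrightarrow>
    B \<subseteq> {1..N} \<and> card B = card S \<and> (\<forall>j. card (B \<inter> {j<..}) \<le> card (S \<inter> {j<..}))"
proof -
  have "card (S \<inter> {..j}) \<le> card (B \<inter> {..j}) \<longleftrightarrow> card (B \<inter> {j<..}) \<le> card (S \<inter> {j<..})"
    if "B \<subseteq> {1..N}" "card B = card S" for j
  proof -
    have "finite B" "finite S" using that(1) assms finite_subset[of _ "{1..N}"] by simp_all
    then show ?thesis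
      using card_split_at[of B j] card_split_at[of S j] that(2) by linarith
  qed
  moreover have "B \<in> bases (schubert N S) \<longleftrightarrow>
      B \<subseteq> {1..N} \<and> card B = card S \<and> (\<forall>j. card (S \<inter> {..j}) \<le> card (B \<inter> {..j}))"
  proof -
    have "finite S" "B \<subseteq> {1..N} \<Longrightarrow> finite B" using assms finite_subset by blast+
    then show ?thesis
      using schubert_basis_iff[of B S]
      unfolding schubert_def basis_system.simps mem_Collect_eq by metis
  qed
  ultimately show ?thesis by metis
qed

text \<open>Every element \<open>e\<close> of \<open>X\<close> missing from \<open>I\<close> is
  blocked by a tail starting before \<open>e\<close> whose bound is attained. At the smallest such
  position \<open>j\<close>, no element of \<open>X\<close> up to \<open>j\<close> is missing, and
  beyond \<open>j\<close> the set \<open>I\<close> has as many elements as \<open>S\<close>.\<close>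

lemma maximal_schubert_indep_card:
  fixes N :: nat
  assumes S: "S \<subseteq> {1..N}" and X: "X \<subseteq> {1..N}" and I: "I \<subseteq> X"
    and tail: "\<And>j. card (I \<inter> {j<..}) \<le> card (S \<inter> {j<..})"
    and max: "\<And>e. e \<in> X - I \<Longrightarrow> \<exists>j. card (S \<inter> {j<..}) < card (insert e I \<inter> {j<..})"
  shows "\<exists>j\<le>N. card I = card (X \<inter> {..j}) + card (S \<inter> {j<..})"
proof -
  have fin: "finite I" by (rule finite_subset[OF order_trans[OF I X]]) simp
  define P where "P = (\<lambda>j. card (I \<inter> {j<..}) = card (S \<inter> {j<..}))"
  have tight: "\<exists>j<e. P j" if e: "e \<in> X - I" for e
  proof -
    obtain j where j: "card (S \<inter> {j<..}) < card (insert e I \<inter> {j<..})" using max[OF e] ..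
    have "j < e" using j tail[of j] by (cases "j < e") auto
    then have "insert e I \<inter> {j<..} = insert e (I \<inter> {j<..})" by auto
    then have "card (insert e I \<inter> {j<..}) = Suc (card (I \<inter> {j<..}))" using e fin by simp
    then have "P j" using j tail[of j] by (simp add: P_def)
    then show ?thesis using \<open>j < e\<close> by blast
  qed
  show ?thesis
  proof (cases "X = I")
    case True
    \<comment> \<open>With nothing missing, the cut at \<open>N\<close> works, as the tail of
      \<open>S\<close> there is empty.\<close>
    have "S \<inter> {N<..} = {}" "X \<inter> {..N} = I" using S X True by auto
    then show ?thesis by (intro exI[of _ N]) simp
  next
    case False
    then obtain e where e: "e \<in> X - I" using I by blast
    then obtain i where "i < e" "P i" using tight by blast
    define j where "j = (LEAST j. P j)"
    have "P j" unfolding j_def using \<open>P i\<close> by (rule LeastI)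
    have least: "j \<le> i" if "P i" for i unfolding j_def using that by (rule Least_le)
    have "X \<inter> {..j} = I \<inter> {..j}"
    proof (intro equalityI subsetI)
      fix e assume "e \<in> X \<inter> {..j}"
      moreover have "j < e" if "e \<in> X - I"
        using tight[OF that] least by (meson le_less_trans)
      ultimately show "e \<in> I \<inter> {..j}" by auto
    qed (use I in auto)
    moreover have "j \<le> N" using least[OF \<open>P i\<close>] \<open>i < e\<close> e X by auto
    ultimately show ?thesis using card_split_at[OF fin, of j] \<open>P j\<close> by (auto simp: P_def)
  qed
qed

text \<open>A maximal extension exists by finiteness. It is phrased with tail bounds instead of
  \<open>indep\<close>, since it serves to prove that the two notions agree.\<close>

lemma schubert_indep_extend:
  fixes N :: nat
  assumes S: "S \<subseteq> {1..N}" and X: "X \<subseteq> {1..N}" and I: "I \<subseteq> X"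
    and tail: "\<And>j. card (I \<inter> {j<..}) \<le> card (S \<inter> {j<..})"
  obtains J j where "I \<subseteq> J" "J \<subseteq> X" "\<And>j. card (J \<inter> {j<..}) \<le> card (S \<inter> {j<..})"
    "j \<le> N" "card J = card (X \<inter> {..j}) + card (S \<inter> {j<..})"
proof -
  define A where "A = {J. I \<subseteq> J \<and> J \<subseteq> X \<and> (\<forall>j. card (J \<inter> {j<..}) \<le> card (S \<inter> {j<..}))}"
  have "finite X" by (rule finite_subset[OF X]) simp
  then have "finite A" by (auto simp: A_def intro: finite_subset[of _ "Pow X"])
  moreover have "A \<noteq> {}" using I tail by (auto simp: A_def)
  ultimately have "\<exists>J\<in>A. \<forall>K\<in>A. J \<subseteq> K \<longrightarrow> J = K" by (rule finite_has_maximal)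
  then obtain J where J: "J \<in> A" and max: "\<And>K. K \<in> A \<Longrightarrow> J \<subseteq> K \<Longrightarrow> J = K" by blast
  have sub: "I \<subseteq> J" "J \<subseteq> X" and J_tail: "\<And>j. card (J \<inter> {j<..}) \<le> card (S \<inter> {j<..})"
    using J by (auto simp: A_def)
  have "\<exists>j. card (S \<inter> {j<..}) < card (insert e J \<inter> {j<..})" if "e \<in> X - J" for e
  proof (rule ccontr)
    assume "\<not> ?thesis"
    then have "\<forall>j. card (insert e J \<inter> {j<..}) \<le> card (S \<inter> {j<..})" by (meson not_le)
    then have "insert e J \<in> A" using sub that by (auto simp: A_def)
    then have "J = insert e J" by (rule max) blast
    then show False using that by blast
  qed
  then obtain j where "j \<le> N" "card J = card (X \<inter> {..j}) + card (S \<inter> {j<..})"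
    using maximal_schubert_indep_card[OF S X sub(2) J_tail] by blast
  with that sub J_tail show ?thesis by blast
qed

lemma indep_schubert_iff:
  assumes S: "S \<subseteq> {1..N}"
  shows "indep (schubert N S) I \<longleftrightarrow>
    I \<subseteq> {1..N} \<and> (\<forall>j. card (I \<inter> {j<..}) \<le> card (S \<inter> {j<..}))"
proof
  assume "indep (schubert N S) I"
  then obtain B where B: "I \<subseteq> B" "B \<in> bases (schubert N S)" by (auto simp: indep_def)
  have "finite B" using B finite_subset[of B "{1..N}"] by (simp add: schubert_bases[OF S])
  then have "card (I \<inter> {j<..}) \<le> card (B \<inter> {j<..})" for j
    using B by (intro card_mono) auto
  then show "I \<subseteq> {1..N} \<and> (\<forall>j. card (I \<inter> {j<..}) \<le> card (S \<inter> {j<..}))"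
    using B order_trans unfolding schubert_bases[OF S] by meson
next
  assume I: "I \<subseteq> {1..N} \<and> (\<forall>j. card (I \<inter> {j<..}) \<le> card (S \<inter> {j<..}))"
  then obtain J j where J: "I \<subseteq> J" "J \<subseteq> {1..N}" "\<And>j. card (J \<inter> {j<..}) \<le> card (S \<inter> {j<..})"
    "j \<le> N" "card J = card ({1..N} \<inter> {..j}) + card (S \<inter> {j<..})"
    using schubert_indep_extend[OF S order_refl] by blast
  have fin: "finite S" by (rule finite_subset[OF S]) simp
  \<comment> \<open>The size of \<open>J\<close> is given by a cut at \<open>j\<close>, and up to
    \<open>j\<close> the set \<open>S\<close> has at most as many elements as the whole ground
    set.\<close>
  have "card S \<le> card J"
  proof -
    have "card (S \<inter> {..j}) \<le> card ({1..N} \<inter> {..j})" using S by (intro card_mono) auto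
    then show ?thesis using J(5) card_split_at[OF fin, of j] by simp
  qed
  moreover have "card J \<le> card S"
  proof -
    have "J \<inter> {0<..} = J" "S \<inter> {0<..} = S" using J(2) S by auto
    then show ?thesis using J(3)[of 0] by simp
  qed
  ultimately have "J \<in> bases (schubert N S)" using J by (simp add: schubert_bases[OF S])
  then show "indep (schubert N S) I" using J by (auto simp: indep_def)
qed

text \<open>A min-max argument: cutting an independent set at \<open>k\<close> bounds its size by
  \<open>r\<close>, while extending the empty set inside \<open>X\<close> produces an independent
  set whose size is itself the value of some cut, hence at least \<open>r\<close>.\<close>

lemma rank_of_schubert:
  assumes S: "S \<subseteq> {1..N}" and X: "X \<subseteq> {1..N}" and r: "r = card (X \<inter> {..k}) + card (S \<inter> {k<..})"
    and min: "\<And>j. j \<le> N \<Longrightarrow> r \<le> card (X \<inter> {..j}) + card (S \<inter> {j<..})"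
  shows "rank_of (schubert N S) X = r"
proof -
  have fin: "finite X" by (rule finite_subset[OF X]) simp
  have le: "card I \<le> r" if I: "I \<subseteq> X" and tail: "\<And>j. card (I \<inter> {j<..}) \<le> card (S \<inter> {j<..})" for I
  proof -
    have "finite I" using I fin by (rule finite_subset)
    moreover have "card (I \<inter> {..k}) \<le> card (X \<inter> {..k})"
      using I fin by (intro card_mono) auto
    ultimately show ?thesis using card_split_at[of I k] tail[of k] r by simp
  qed
  obtain I j where I: "I \<subseteq> X" "\<And>j. card (I \<inter> {j<..}) \<le> card (S \<inter> {j<..})"
    "j \<le> N" "card I = card (X \<inter> {..j}) + card (S \<inter> {j<..})"
    using schubert_indep_extend[OF S X, of "{}"] by auto
  have "card I = r" using le[OF I(1,2)] min[OF I(3)] I(4) by simp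
  then show ?thesis
    using I X le fin by (intro rank_of_eqI[of X I]) (auto simp: indep_schubert_iff[OF S])
qed

section \<open>Block structure, rank and flats of the Catalan matroid\<close>

lemma catalan_vector_nth:
  "i < n * (a + b) \<Longrightarrow> catalan_vector a b n ! i = (if i mod (a + b) < a then 0 else 1)"
proof (induction n arbitrary: i)
  case (Suc n)
  have rec: "catalan_vector a b (Suc n) = (replicate a 0 @ replicate b 1) @ catalan_vector a b n"
    by (simp add: catalan_vector_def)
  show ?case
  proof (cases "i < a + b")
    case True
    then show ?thesis unfolding rec by (subst nth_append) (auto simp: nth_append)
  next
    case False
    then have "catalan_vector a b (Suc n) ! i = catalan_vector a b n ! (i - (a + b))"
      unfolding rec by (subst nth_append) auto
    then show ?thesis using Suc False by (simp add: le_mod_geq)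
  qed
qed simp

lemma mem_catalan_set_iff:
  "p \<in> catalan_set a b n \<longleftrightarrow> p \<in> {1..n * (a + b)} \<and> a \<le> (p - 1) mod (a + b)"
proof (cases "p \<in> {1..n * (a + b)}")
  case True
  then have "p - 1 < n * (a + b)" by auto
  with True show ?thesis by (auto simp: catalan_set_def catalan_vector_nth)
qed (auto simp: catalan_set_def)

lemma catalan_set_subset: "catalan_set a b n \<subseteq> {1..n * (a + b)}"
  by (auto simp: catalan_set_def)

text \<open>The ones of block \<open>q\<close> occupy its last \<open>b\<close> positions, so a tail
  starting at offset \<open>u\<close> meets that block only beyond offset
  \<open>max a u\<close>.\<close>

lemma catalan_set_tail:
  assumes "q < n" "u \<le> a + b"
  shows "catalan_set a b n \<inter> {q * (a + b) + u<..} =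
    {q * (a + b) + max a u<..Suc q * (a + b)} \<union> catalan_set a b n \<inter> {Suc q * (a + b)<..}"
proof -
  have "p \<in> catalan_set a b n \<longleftrightarrow> q * (a + b) + a < p"
    if p: "q * (a + b) < p" "p \<le> Suc q * (a + b)" for p
  proof -
    define r where "r = p - 1 - q * (a + b)"
    have r: "p - 1 = r + q * (a + b)" "r < a + b" using p by (auto simp: r_def)
    have "Suc q * (a + b) \<le> n * (a + b)" using assms by (intro mult_right_mono) auto
    then have "p \<in> {1..n * (a + b)}" using p by auto
    moreover have "(p - 1) mod (a + b) = r" unfolding r(1) using r(2) by simp
    moreover have "a \<le> r \<longleftrightarrow> q * (a + b) + a < p" using p by (auto simp: r_def)
    ultimately show ?thesis by (simp add: mem_catalan_set_iff)
  qed
  moreover have "p \<in> {q * (a + b) + u<..} \<longleftrightarrow>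
      p \<in> {q * (a + b) + u<..Suc q * (a + b)} \<or> p \<in> {Suc q * (a + b)<..}" for p
    using assms by auto
  ultimately show ?thesis
    by (intro set_eqI) (force simp del: mult_Suc)
qed

lemma card_catalan_set_tail_block:
  "q \<le> n \<Longrightarrow> card (catalan_set a b n \<inter> {q * (a + b)<..}) = (n - q) * b"
proof (induction "n - q" arbitrary: q)
  case 0
  have "catalan_set a b n \<inter> {q * (a + b)<..} = {}"
    using 0 catalan_set_subset[of a b n] by auto
  then show ?case using 0 by simp
next
  case (Suc m)
  have fin: "finite (catalan_set a b n)" by (simp add: catalan_set_def)
  have "card (catalan_set a b n \<inter> {q * (a + b)<..}) = b + card (catalan_set a b n \<inter> {Suc q * (a + b)<..})"
    using catalan_set_tail[of q n 0 a b] Suc(2) fin by (simp add: card_Un_disjoint disjoint_iff)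
  also have "\<dots> = b + (n - Suc q) * b" using Suc by (simp del: mult_Suc)
  also have "\<dots> = (n - q) * b" using Suc(2) by (metis Suc_diff_Suc mult_Suc zero_less_Suc zero_less_diff)
  finally show ?case .
qed

lemma card_catalan_set_tail:
  assumes "q < n" "u \<le> a + b"
  shows "card (catalan_set a b n \<inter> {q * (a + b) + u<..}) = a + b - max a u + (n - Suc q) * b"
proof -
  have "finite (catalan_set a b n)" by (simp add: catalan_set_def)
  then show ?thesis
    unfolding catalan_set_tail[OF assms]
    using assms card_catalan_set_tail_block[of "Suc q" n a b]
    by (subst card_Un_disjoint) (auto simp: disjoint_iff)
qed

text \<open>The value of the cut in \<open>rank_of_schubert\<close> at the end of block
  \<open>j\<close>, with block length \<open>c\<close>; the Catalan set has
  \<open>(n - j) * b\<close> elements after it.\<close>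

definition block_height :: "nat \<Rightarrow> nat \<Rightarrow> nat \<Rightarrow> nat set \<Rightarrow> nat \<Rightarrow> nat" where
  "block_height b c n F j = card (F \<inter> {..j * c}) + (n - j) * b"

text \<open>Ties are broken in favour of the earliest minimizer, so that every set is cut at exactly
  one place.\<close>

definition first_min :: "nat \<Rightarrow> nat \<Rightarrow> nat \<Rightarrow> nat set \<Rightarrow> nat \<Rightarrow> bool" where
  "first_min b c n F k \<longleftrightarrow> k \<le> n \<and>
     (\<forall>j<k. block_height b c n F k < block_height b c n F j) \<and>
     (\<forall>j\<le>n. block_height b c n F k \<le> block_height b c n F j)"

lemma ex1_first_min: "\<exists>!k. first_min b c n F k"
proof -
  define P where "P k \<longleftrightarrow> k \<le> n \<and> (\<forall>j\<le>n. block_height b c n F k \<le> block_height b c n F j)" for k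
  have "\<exists>k\<in>{..n}. \<forall>j\<in>{..n}. block_height b c n F k \<le> block_height b c n F j"
    using ex_min_if_finite[of "block_height b c n F ` {..n}"] by (auto simp: not_less)
  then have ex: "\<exists>k. P k" by (auto simp: P_def)
  define k where "k = (LEAST k. P k)"
  have k: "P k" using ex unfolding k_def by (rule LeastI_ex)
  have least: "\<not> P j" if "j < k" for j using that unfolding k_def by (rule not_less_Least)
  show ?thesis
  proof
    show "first_min b c n F k"
      using k least unfolding first_min_def P_def
      by (meson le_less_trans less_imp_le not_le order_trans)
  next
    fix k' assume "first_min b c n F k'"
    then have "P k'" and "\<And>j. j < k' \<Longrightarrow> \<not> P j"
      by (auto simp: first_min_def P_def not_le)
    then show "k' = k" using k least by (metis linorder_neqE_nat)
  qed
qed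

text \<open>Among all cuts only those at block boundaries matter: any other cut can be moved to an
  end of its block without increasing its value.\<close>

lemma rank_of_catalan:
  assumes F: "F \<subseteq> {1..n * (a + b)}" and k: "k \<le> n"
    and min: "\<And>j. j \<le> n \<Longrightarrow> block_height b (a + b) n F k \<le> block_height b (a + b) n F j"
  shows "rank_of (catalan a b n) F = block_height b (a + b) n F k"
  unfolding catalan_def
proof (rule rank_of_schubert[OF catalan_set_subset F])
  let ?c = "a + b"
  have fin: "finite F" by (rule finite_subset[OF F]) simp
  show "block_height b ?c n F k = card (F \<inter> {..k * ?c}) + card (catalan_set a b n \<inter> {k * ?c<..})"
    using k by (simp add: block_height_def card_catalan_set_tail_block)
  fix t assume t: "t \<le> n * ?c"
  have "\<exists>j\<le>n. block_height b ?c n F j \<le> card (F \<inter> {..t}) + card (catalan_set a b n \<inter> {t<..})"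
  proof (cases "t = n * ?c")
    case True
    then show ?thesis
      by (intro exI[of _ n]) (simp add: block_height_def)
  next
    case False
    then have pos: "0 < ?c" using t by (cases "?c = 0") auto
    define q u where "q = t div ?c" and "u = t mod ?c"
    have tq: "t = q * ?c + u" unfolding q_def u_def by (rule div_mult_mod_eq[symmetric])
    have u: "u < ?c" using pos by (simp add: u_def)
    have q: "q < n" using t False pos by (simp add: q_def less_mult_imp_div_less)
    show ?thesis
    \<comment> \<open>Within the zeros, moving back to the block start leaves the tail count
      unchanged and can only lose elements of \<open>F\<close>. Within the ones, moving on to the
      block end gains at most \<open>?c - u\<close> elements of \<open>F\<close> and drops exactly
      that many from the tail.\<close>
    proof (cases "u \<le> a")
      case True
      have "card (F \<inter> {..q * ?c}) \<le> card (F \<inter> {..t})"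
        using fin tq by (intro card_mono) auto
      moreover have "b + (n - Suc q) * b = (n - q) * b"
        using q by (metis Suc_diff_Suc mult_Suc)
      ultimately have "block_height b ?c n F q \<le> card (F \<inter> {..t}) + card (catalan_set a b n \<inter> {t<..})"
        using q u True unfolding tq by (simp add: block_height_def card_catalan_set_tail)
      then show ?thesis using q by (intro exI[of _ q]) simp
    next
      case False
      have "card (F \<inter> {..Suc q * ?c}) \<le> card (F \<inter> {..t} \<union> {t<..Suc q * ?c})"
        using fin by (intro card_mono) auto
      also have "\<dots> \<le> card (F \<inter> {..t}) + (?c - u)"
        by (rule order_trans[OF card_Un_le]) (simp add: tq)
      finally have "block_height b ?c n F (Suc q) \<le> card (F \<inter> {..t}) + card (catalan_set a b n \<inter> {t<..})"
        using q u False unfolding tq by (simp add: block_height_def card_catalan_set_tail)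
      then show ?thesis using q by (intro exI[of _ "Suc q"]) simp
    qed
  qed
  then show "block_height b ?c n F k \<le> card (F \<inter> {..t}) + card (catalan_set a b n \<inter> {t<..})"
    using min order_trans by blast
qed

lemma block_height_insert:
  assumes "finite F" "e \<notin> F"
  shows "block_height b c n (insert e F) j = block_height b c n F j + (if e \<le> j * c then 1 else 0)"
  using assms by (simp add: block_height_def Int_insert_left)

text \<open>Adding \<open>e\<close> raises exactly the heights at block ends not before
  \<open>e\<close>. If \<open>e\<close> lies after block \<open>k\<close>, the minimum at
  \<open>k\<close> survives; otherwise all minimizers, none of which precedes \<open>k\<close>, are
  raised, so the rank grows.\<close>

lemma is_flat_catalan_iff:
  assumes F: "F \<subseteq> {1..n * (a + b)}" and k: "first_min b (a + b) n F k"
  shows "is_flat (catalan a b n) F \<longleftrightarrow> {k * (a + b)<..n * (a + b)} \<subseteq> F"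
proof -
  let ?c = "a + b" and ?r = "rank_of (catalan a b n)"
  let ?h = "block_height b ?c n"
  have fin: "finite F" by (rule finite_subset[OF F]) simp
  have rF: "?r F = ?h F k"
    using k by (intro rank_of_catalan[OF F]) (auto simp: first_min_def)
  have step: "?r F < ?r (insert e F) \<longleftrightarrow> e \<le> k * ?c" if e: "e \<in> {1..n * ?c} - F" for e
  proof -
    have eF: "insert e F \<subseteq> {1..n * ?c}" using e F by auto
    obtain l where l: "first_min b ?c n (insert e F) l" using ex1_first_min by blast
    then have rl: "?r (insert e F) = ?h (insert e F) l" "l \<le> n"
      by (auto intro: rank_of_catalan[OF eF] simp: first_min_def)
    have hl: "?h (insert e F) j = ?h F j + (if e \<le> j * ?c then 1 else 0)" for j
      using e by (intro block_height_insert fin) auto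
    show ?thesis
    proof
      assume "?r F < ?r (insert e F)"
      moreover have "?h (insert e F) l \<le> ?h (insert e F) k"
        using l k by (auto simp: first_min_def)
      ultimately show "e \<le> k * ?c" using rF rl hl[of k] by (auto split: if_splits)
    next
      assume ek: "e \<le> k * ?c"
      show "?r F < ?r (insert e F)"
      proof (cases "e \<le> l * ?c")
        case True
        have "?h F k \<le> ?h F l" using k rl by (auto simp: first_min_def)
        then show ?thesis using rF rl hl[of l] True by simp
      next
        \<comment> \<open>A minimizer \<open>l\<close> of the new heights that was not raised lies
          before \<open>k\<close>, where the old height is strictly larger than at
          \<open>k\<close>.\<close>
        case False
        then have "l < k" using ek mult_le_mono1[of k l ?c] by (meson not_le order_trans)
        then have "?h F k < ?h F l" using k by (auto simp: first_min_def)
        then show ?thesis using rF rl hl[of l] by simp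
      qed
    qed
  qed
  have ground: "ground (catalan a b n) = {1..n * ?c}" by (simp add: catalan_def schubert_def)
  have "is_flat (catalan a b n) F \<longleftrightarrow> (\<forall>e\<in>{1..n * ?c} - F. ?r F < ?r (insert e F))"
    unfolding is_flat_def ground using F by blast
  also have "\<dots> \<longleftrightarrow> (\<forall>e\<in>{1..n * ?c} - F. e \<le> k * ?c)"
    by (rule ball_cong[OF refl]) (rule step)
  also have "\<dots> \<longleftrightarrow> {k * ?c<..n * ?c} \<subseteq> F"
  proof
    assume *: "\<forall>e\<in>{1..n * ?c} - F. e \<le> k * ?c"
    show "{k * ?c<..n * ?c} \<subseteq> F"
    proof
      fix e assume e: "e \<in> {k * ?c<..n * ?c}"
      then have "e \<in> {1..n * ?c}" by auto
      then show "e \<in> F" using * e by (meson DiffI greaterThanAtMost_iff not_le)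
    qed
  qed (meson DiffD1 DiffD2 atLeastAtMost_iff greaterThanAtMost_iff not_le subsetD)
  finally show ?thesis .
qed

section \<open>Decomposition at the first minimum\<close>

text \<open>The sets on \<open>k\<close> blocks whose height has its unique minimum at the end.
  Comparing suffixes with the final height removes any reference to a total number of
  blocks.\<close>

definition below_sets :: "nat \<Rightarrow> nat \<Rightarrow> nat \<Rightarrow> nat set set" where
  "below_sets b c k = {X. X \<subseteq> {1..k * c} \<and> (\<forall>j<k. card (X \<inter> {j * c<..}) < (k - j) * b)}"

text \<open>The sets on \<open>m\<close> blocks whose height never drops below its initial
  value.\<close>

definition above_sets :: "nat \<Rightarrow> nat \<Rightarrow> nat \<Rightarrow> nat set set" where
  "above_sets b c m = {Y. Y \<subseteq> {1..m * c} \<and> (\<forall>j\<le>m. j * b \<le> card (Y \<inter> {..j * c}))}"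

definition concat_blocks :: "nat \<Rightarrow> nat set \<Rightarrow> nat set \<Rightarrow> nat set" where
  "concat_blocks s X Y = X \<union> (\<lambda>y. y + s) ` Y"

lemma card_concat_blocks:
  assumes "X \<subseteq> {1..s}" "finite Y" "0 \<notin> Y"
  shows "card (concat_blocks s X Y) = card X + card Y"
proof -
  have "finite X" by (rule finite_subset[OF assms(1)]) simp
  then have "card (concat_blocks s X Y) = card X + card ((\<lambda>y. y + s) ` Y)"
    unfolding concat_blocks_def using assms by (intro card_Un_disjoint) auto
  then show ?thesis by (simp add: card_image)
qed

text \<open>Relative to the height at \<open>k\<close>, earlier heights depend only on
  \<open>X\<close> and later ones only on \<open>Y\<close>, so being the first minimizer splits into
  two independent conditions.\<close>

lemma first_min_concat_blocks:
  assumes k: "k \<le> n" and X: "X \<subseteq> {1..k * c}" and Y: "Y \<subseteq> {1..(n - k) * c}"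
  shows "first_min b c n (concat_blocks (k * c) X Y) k \<longleftrightarrow> X \<in> below_sets b c k \<and> Y \<in> above_sets b c (n - k)"
proof -
  let ?F = "concat_blocks (k * c) X Y"
  let ?h = "block_height b c n ?F"
  have finX: "finite X" by (rule finite_subset[OF X]) simp
  have finY: "finite Y" by (rule finite_subset[OF Y]) simp
  have above: "?h k \<le> ?h (k + i) \<longleftrightarrow> i * b \<le> card (Y \<inter> {..i * c})" if i: "i \<le> n - k" for i
  proof -
    have h: "?h (k + i) = card X + card (Y \<inter> {..i * c}) + (n - (k + i)) * b" for i
    proof -
      have "?F \<inter> {..(k + i) * c} = concat_blocks (k * c) X (Y \<inter> {..i * c})"
        using X by (fastforce simp: concat_blocks_def algebra_simps)
      then show ?thesis
        using Y finY by (subst card_concat_blocks[OF X, symmetric]) (auto simp: block_height_def)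
    qed
    have "Y \<inter> {..0} = {}" using Y by auto
    moreover have "n - k = n - (k + i) + i" using i by linarith
    then have "(n - k) * b = (n - (k + i)) * b + i * b" by (metis add_mult_distrib)
    ultimately show ?thesis using h[of 0] h[of i] by auto
  qed
  have below: "?h k < ?h j \<longleftrightarrow> card (X \<inter> {j * c<..}) < (k - j) * b" if j: "j < k" for j
  proof -
    have jk: "j * c \<le> k * c" using j by simp
    have "j * c < y + k * c" if "y \<in> Y" for y
      using that Y by (intro le_less_trans[OF jk]) auto
    then have "?F \<inter> {..j * c} = X \<inter> {..j * c}"
      by (auto simp: concat_blocks_def not_le[symmetric])
    moreover have "?F \<inter> {..k * c} = X"
      using X Y by (auto simp: concat_blocks_def)
    moreover have "n - j = n - k + (k - j)" using j k by linarith
    then have "(n - j) * b = (n - k) * b + (k - j) * b" by (metis add_mult_distrib)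
    ultimately show ?thesis
      using card_split_at[OF finX, of "j * c"] by (simp add: block_height_def)
  qed
  have "first_min b c n ?F k \<longleftrightarrow> (\<forall>j<k. ?h k < ?h j) \<and> (\<forall>i\<le>n - k. ?h k \<le> ?h (k + i))"
    (is "_ \<longleftrightarrow> ?L \<and> ?R")
  proof
    assume L: "?L \<and> ?R"
    have "?h k \<le> ?h j" if "j \<le> n" for j
    proof (cases "j < k")
      case False
      then obtain i where "j = k + i" using le_Suc_ex[of k j] by auto
      then show ?thesis using L that by auto
    qed (use L in \<open>simp add: less_imp_le\<close>)
    then show "first_min b c n ?F k" using L k by (auto simp: first_min_def)
  qed (use k in \<open>auto simp: first_min_def\<close>)
  also have "\<dots> \<longleftrightarrow> X \<in> below_sets b c k \<and> Y \<in> above_sets b c (n - k)"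
    using above below X Y by (auto simp: below_sets_def above_sets_def)
  finally show ?thesis .
qed

lemma split_blocks:
  assumes F: "F \<subseteq> {1..n * c}" and k: "k \<le> n"
  obtains X Y where "X \<subseteq> {1..k * c}" "Y \<subseteq> {1..(n - k) * c}" "F = concat_blocks (k * c) X Y"
proof
  show "F \<inter> {..k * c} \<subseteq> {1..k * c}" using F by auto
  show "(\<lambda>y. y - k * c) ` (F \<inter> {k * c<..}) \<subseteq> {1..(n - k) * c}"
  proof (rule image_subsetI)
    fix y assume "y \<in> F \<inter> {k * c<..}"
    then have "k * c < y" "y \<le> n * c" using F by auto
    then show "y - k * c \<in> {1..(n - k) * c}" unfolding diff_mult_distrib by auto
  qed
  have "(\<lambda>y. y + k * c) ` (\<lambda>y. y - k * c) ` (F \<inter> {k * c<..}) = id ` (F \<inter> {k * c<..})"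
    unfolding image_image by (rule image_cong) auto
  then show "F = concat_blocks (k * c) (F \<inter> {..k * c}) ((\<lambda>y. y - k * c) ` (F \<inter> {k * c<..}))"
    by (auto simp: concat_blocks_def)
qed

lemma concat_blocks_subset:
  assumes "k \<le> n" "X \<subseteq> {1..k * c}" "Y \<subseteq> {1..(n - k) * c}"
  shows "concat_blocks (k * c) X Y \<subseteq> {1..n * c}"
proof -
  have "n * c = k * c + (n - k) * c" using assms(1) by (simp flip: add_mult_distrib)
  then show ?thesis using assms by (fastforce simp: concat_blocks_def)
qed

lemma inj_on_concat_blocks:
  "inj_on (\<lambda>(X, Y). concat_blocks s X Y) (Pow {1..s} \<times> {Y. finite Y \<and> 0 \<notin> Y})"
proof -
  \<comment> \<open>The condition \<open>y > 0\<close> is there because \<open>s\<close> itself, the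
    shift of 0, may belong to \<open>X\<close>.\<close>
  have "concat_blocks s X Y \<inter> {..s} = X" "{y. y + s \<in> concat_blocks s X Y \<and> y > 0} = Y"
    if "X \<subseteq> {1..s}" "0 \<notin> Y" for X Y
    using that by (auto simp: concat_blocks_def intro: gr0I)
  then show ?thesis
    by (intro inj_onI) (clarsimp, metis)
qed

lemma sum_first_min:
  fixes f :: "nat set \<Rightarrow> rat poly"
  assumes "finite A"
  shows "(\<Sum>F\<in>A. f F) = (\<Sum>k\<le>n. \<Sum>F | F \<in> A \<and> first_min b c n F k. f F)"
proof -
  define g where "g F = (THE k. first_min b c n F k)" for F
  have g: "g F = k \<longleftrightarrow> first_min b c n F k" for F k
    using theI'[OF ex1_first_min[of b c n F]] ex1_first_min[of b c n F] unfolding g_def by blast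
  have "g ` A \<subseteq> {..n}" using g by (auto simp: first_min_def)
  then have "(\<Sum>F\<in>A. f F) = (\<Sum>k\<in>{..n}. \<Sum>F\<in>{F \<in> A. g F = k}. f F)"
    using assms by (intro sum.group[symmetric]) auto
  then show ?thesis by (simp add: g)
qed

lemma bij_betw_concat_blocks:
  assumes k: "k \<le> n"
  shows "bij_betw (\<lambda>(X, Y). concat_blocks (k * c) X Y) (below_sets b c k \<times> above_sets b c (n - k))
    {F. F \<subseteq> {1..n * c} \<and> first_min b c n F k}"
proof (rule bij_betw_imageI)
  show "inj_on (\<lambda>(X, Y). concat_blocks (k * c) X Y) (below_sets b c k \<times> above_sets b c (n - k))"
    by (rule inj_on_subset[OF inj_on_concat_blocks])
       (auto simp: below_sets_def above_sets_def intro: finite_subset)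
  show "(\<lambda>(X, Y). concat_blocks (k * c) X Y) ` (below_sets b c k \<times> above_sets b c (n - k)) =
      {F. F \<subseteq> {1..n * c} \<and> first_min b c n F k}" (is "?f ` ?P = ?Q")
  proof (intro equalityI subsetI)
    fix F assume "F \<in> ?f ` ?P"
    then obtain X Y where F: "F = concat_blocks (k * c) X Y" "X \<in> below_sets b c k" "Y \<in> above_sets b c (n - k)"
      by auto
    then have "X \<subseteq> {1..k * c}" "Y \<subseteq> {1..(n - k) * c}" by (auto simp: below_sets_def above_sets_def)
    with F k concat_blocks_subset[OF k] show "F \<in> ?Q" by (simp add: first_min_concat_blocks)
  next
    fix F assume F: "F \<in> ?Q"
    then obtain X Y where XY: "X \<subseteq> {1..k * c}" "Y \<subseteq> {1..(n - k) * c}" "F = concat_blocks (k * c) X Y"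
      using split_blocks[of F n c k] k by blast
    then have "(X, Y) \<in> ?P" using F k by (simp add: first_min_concat_blocks)
    then show "F \<in> ?f ` ?P" using XY(3) by (intro rev_image_eqI) auto
  qed
qed

text \<open>Each subset is cut at its first minimizer, and sizes add under concatenation. This is
  the coefficientwise form of \<open>T = A * N\<close> below.\<close>

lemma sum_subsets_factorization:
  "(\<Sum>F\<in>Pow {1..n * c}. monom (1::rat) (card F)) =
    (\<Sum>k\<le>n. (\<Sum>X\<in>below_sets b c k. monom 1 (card X)) * (\<Sum>Y\<in>above_sets b c (n - k). monom 1 (card Y)))"
proof -
  have "(\<Sum>F | F \<in> Pow {1..n * c} \<and> first_min b c n F k. monom (1::rat) (card F)) =
      (\<Sum>X\<in>below_sets b c k. monom 1 (card X)) * (\<Sum>Y\<in>above_sets b c (n - k). monom 1 (card Y))"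
    if k: "k \<le> n" for k
  proof -
    have "card (concat_blocks (k * c) X Y) = card X + card Y"
      if "X \<in> below_sets b c k" "Y \<in> above_sets b c (n - k)" for X Y
      using that by (intro card_concat_blocks)
        (auto simp: below_sets_def above_sets_def intro: finite_subset)
    then have "(\<Sum>(X, Y)\<in>below_sets b c k \<times> above_sets b c (n - k). monom (1::rat) (card (concat_blocks (k * c) X Y))) =
        (\<Sum>(X, Y)\<in>below_sets b c k \<times> above_sets b c (n - k). monom 1 (card X) * monom 1 (card Y))"
      by (intro sum.cong) (auto simp: mult_monom)
    also have "\<dots> = (\<Sum>X\<in>below_sets b c k. monom 1 (card X)) * (\<Sum>Y\<in>above_sets b c (n - k). monom 1 (card Y))"
      by (simp add: sum_product sum.cartesian_product)
    finally show ?thesis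
      using sum.reindex_bij_betw[OF bij_betw_concat_blocks[OF k, of c b], of "\<lambda>F. monom (1::rat) (card F)"]
      by (simp add: case_prod_unfold)
  qed
  then show ?thesis
    by (subst sum_first_min[where n = n and b = b and c = c]) auto
qed

text \<open>A flat with first minimizer \<open>k\<close> is an arbitrary member of
  \<open>below_sets\<close> on the first \<open>k\<close> blocks followed by all later elements; its
  rank is its height at \<open>k\<close>.\<close>

lemma whitney_poly_catalan:
  "whitney_poly (catalan a b n) =
    (\<Sum>k\<le>n. (\<Sum>X\<in>below_sets b (a + b) k. monom 1 (card X)) * monom 1 ((n - k) * b))"
proof -
  let ?c = "a + b" and ?M = "catalan a b n"
  have flat_sub: "F \<subseteq> {1..n * ?c}" if "is_flat ?M F" for F
    using that by (simp add: is_flat_def catalan_def schubert_def)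
  have fin: "finite {F. is_flat ?M F}"
    by (rule finite_subset[of _ "Pow {1..n * ?c}"]) (use flat_sub in auto)
  have "(\<Sum>F | F \<in> {F. is_flat ?M F} \<and> first_min b ?c n F k. monom (1::rat) (rank_of ?M F)) =
      (\<Sum>X\<in>below_sets b ?c k. monom 1 (card X)) * monom 1 ((n - k) * b)" if k: "k \<le> n" for k
  proof -
    let ?Y = "{1..(n - k) * ?c}"
    let ?g = "\<lambda>X. concat_blocks (k * ?c) X ?Y"
    \<comment> \<open>Filling the later blocks completely never moves the minimum, since a full
      block has at least \<open>b\<close> elements.\<close>
    have Y: "?Y \<in> above_sets b ?c (n - k)"
    proof -
      have "j * b \<le> card (?Y \<inter> {..j * ?c})" if j: "j \<le> n - k" for j
      proof -
        have "j * ?c \<le> (n - k) * ?c" using j by (rule mult_le_mono1)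
        then have "?Y \<inter> {..j * ?c} = {1..j * ?c}" by auto
        then have "card (?Y \<inter> {..j * ?c}) = j * ?c" by (metis card_atLeastAtMost diff_Suc_1 One_nat_def)
        then show ?thesis by simp
      qed
      then show ?thesis by (simp add: above_sets_def)
    qed
    have nc: "n * ?c = (n - k) * ?c + k * ?c" using k by (simp flip: add_mult_distrib)
    have shift: "(\<lambda>y. y + k * ?c) ` ?Y = {k * ?c<..n * ?c}"
      unfolding nc by (auto simp: image_iff)
    have "{F. F \<in> {F. is_flat ?M F} \<and> first_min b ?c n F k} =
        {F. F \<subseteq> {1..n * ?c} \<and> first_min b ?c n F k \<and> {k * ?c<..n * ?c} \<subseteq> F}"
    proof (intro Collect_cong)
      fix F
      show "F \<in> {F. is_flat ?M F} \<and> first_min b ?c n F k \<longleftrightarrow>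
          F \<subseteq> {1..n * ?c} \<and> first_min b ?c n F k \<and> {k * ?c<..n * ?c} \<subseteq> F"
        using flat_sub[of F] is_flat_catalan_iff[of F n a b k] by blast
    qed
    also have "\<dots> = ?g ` below_sets b ?c k"
    proof (intro equalityI subsetI)
      fix F assume F: "F \<in> {F. F \<subseteq> {1..n * ?c} \<and> first_min b ?c n F k \<and> {k * ?c<..n * ?c} \<subseteq> F}"
      then obtain X Z where XZ: "X \<subseteq> {1..k * ?c}" "Z \<subseteq> {1..(n - k) * ?c}" "F = concat_blocks (k * ?c) X Z"
        using split_blocks[of F n ?c k] k by blast
      have "?Y \<subseteq> Z"
      proof
        fix y assume y: "y \<in> ?Y"
        then have "y + k * ?c \<in> F" using shift F by blast
        then show "y \<in> Z" using XZ y by (auto simp: concat_blocks_def)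
      qed
      then have "Z = ?Y" using XZ by blast
      then show "F \<in> ?g ` below_sets b ?c k"
        using F XZ k by (auto simp: first_min_concat_blocks)
    next
      fix F assume "F \<in> ?g ` below_sets b ?c k"
      then obtain X where X: "F = ?g X" "X \<in> below_sets b ?c k" by blast
      then have sub: "X \<subseteq> {1..k * ?c}" by (auto simp: below_sets_def)
      have "{k * ?c<..n * ?c} \<subseteq> F" unfolding X(1) concat_blocks_def shift by blast
      moreover have "first_min b ?c n F k"
        unfolding X(1) using X(2) Y by (subst first_min_concat_blocks[OF k sub]) auto
      moreover have "F \<subseteq> {1..n * ?c}"
        unfolding X(1) using k sub by (intro concat_blocks_subset) auto
      ultimately show "F \<in> {F. F \<subseteq> {1..n * ?c} \<and> first_min b ?c n F k \<and> {k * ?c<..n * ?c} \<subseteq> F}"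
        by blast
    qed
    finally have eq: "{F. F \<in> {F. is_flat ?M F} \<and> first_min b ?c n F k} = ?g ` below_sets b ?c k" .
    have inj: "inj_on ?g (below_sets b ?c k)"
    proof (rule inj_onI)
      fix X X' assume X: "X \<in> below_sets b ?c k" "X' \<in> below_sets b ?c k" "?g X = ?g X'"
      have "?g X \<inter> {..k * ?c} = X" "?g X' \<inter> {..k * ?c} = X'"
        using X by (auto simp: below_sets_def concat_blocks_def)
      then show "X = X'" unfolding X(3) by (rule trans[OF sym])
    qed
    have rank: "rank_of ?M (?g X) = card X + (n - k) * b" if X: "X \<in> below_sets b ?c k" for X
    proof -
      have sub: "X \<subseteq> {1..k * ?c}" using X by (auto simp: below_sets_def)
      have "first_min b ?c n (?g X) k"
        using X Y by (subst first_min_concat_blocks[OF k sub]) auto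
      then have "rank_of ?M (?g X) = block_height b ?c n (?g X) k"
        using k sub by (intro rank_of_catalan concat_blocks_subset) (auto simp: first_min_def)
      moreover have "?g X \<inter> {..k * ?c} = X" using sub by (auto simp: concat_blocks_def)
      ultimately show ?thesis by (simp add: block_height_def)
    qed
    show ?thesis
      unfolding eq by (subst sum.reindex[OF inj]) (simp add: rank sum_distrib_right mult_monom del: One_nat_def)
  qed
  then show ?thesis
    unfolding whitney_poly_eq_sum_flats[OF is_matroid_catalan]
    by (subst sum_first_min[OF fin, where n = n and b = b and c = ?c]) simp
qed

section \<open>Generating functions\<close>

definition monom_sum :: "nat set set \<Rightarrow> rat poly" where
  "monom_sum A = (\<Sum>X\<in>A. monom 1 (card X))"

lemma coeff_monom_sum_eq_0:
  "(\<And>X. X \<in> A \<Longrightarrow> card X \<noteq> i) \<Longrightarrow> coeff (monom_sum A) i = 0"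
  by (simp add: monom_sum_def coeff_sum)

lemma monom_sum_Pow: "monom_sum (Pow {1..N}) = [:1, 1:] ^ N"
proof -
  have "[:1, 1:] ^ N = (\<Prod>i\<in>{1..N}. monom (1::rat) 1 + 1)"
    by (simp add: monom_Suc one_pCons)
  also have "\<dots> = (\<Sum>X\<in>Pow {1..N}. monom 1 1 ^ card X)"
    by (subst prod_add) simp_all
  finally show ?thesis by (simp add: monom_sum_def monom_power)
qed

text \<open>The Euler operator, a derivation multiplying the \<open>n\<close>-th coefficient by
  \<open>n\<close>; recursions of power sum type become differential equations.\<close>

abbreviation theta :: "rat poly fps \<Rightarrow> rat poly fps" where
  "theta F \<equiv> fps_X * fps_deriv F"

lemma theta_nth: "fps_nth (theta F) n = of_nat n * fps_nth F n"
  by (cases n) (auto simp: fps_X_mult_nth)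

lemma theta_mult: "theta (F * G) = theta F * G + F * theta G"
  by (simp add: algebra_simps)

text \<open>The logarithmic derivative of \<open>T = A * N\<close> is \<open>T - 1\<close>.
  Splitting \<open>T - 1\<close> into its part \<open>B\<close> in degrees below
  \<open>m * b\<close> and the rest separates the contributions of \<open>A\<close> and
  \<open>N\<close>, because products respect these degree ranges.\<close>

lemma below_sets_recursion:
  fixes b c :: nat
  defines "A \<equiv> Abs_fps (\<lambda>k. monom_sum (below_sets b c k))"
    and "B \<equiv> Abs_fps (\<lambda>m. monom_sum {X. X \<subseteq> {1..m * c} \<and> card X < m * b})"
  shows "theta A = A * B"
proof -
  define N where "N = Abs_fps (\<lambda>m. monom_sum (above_sets b c m))"
  define T where "T = Abs_fps (\<lambda>m. monom_sum (Pow {1..m * c}))"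
  have T_nth: "fps_nth T m = [:1, 1:] ^ (m * c)" for m
    by (simp add: T_def monom_sum_Pow del: One_nat_def)
  have T: "T = A * N"
    by (rule fps_ext)
      (simp add: T_def A_def N_def fps_mult_nth monom_sum_def sum_subsets_factorization[of n c b for n, simplified] atLeast0AtMost)
  \<comment> \<open>\<open>T\<close> is a geometric series, so the \<open>n\<close>-th coefficient
    of its square is \<open>n + 1\<close> times its own.\<close>
  have "theta T = T * (T - 1)"
  proof (rule fps_ext)
    fix n
    have "fps_nth (T * T) n = of_nat (Suc n) * fps_nth T n"
      by (simp add: fps_mult_nth T_nth flip: power_add add_mult_distrib)
    then show "fps_nth (theta T) n = fps_nth (T * (T - 1)) n"
      by (simp add: theta_nth algebra_simps)
  qed
  then have eq: "N * (theta A - A * B) = A * (N * (T - 1 - B) - theta N)"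
    unfolding T theta_mult by (simp add: algebra_simps)
  have below: "below_sets b c 0 = {{}}" by (auto simp: below_sets_def)
  have above: "above_sets b c 0 = {{}}" by (auto simp: above_sets_def)
  have A0: "fps_nth A 0 = 1" and N0: "fps_nth N 0 = 1"
    by (simp_all add: A_def N_def below above monom_sum_def)
  have cardA: "card X < m * b" if "X \<in> below_sets b c m" "m \<noteq> 0" for X m
  proof -
    have "X \<inter> {0<..} = X" using that by (auto simp: below_sets_def)
    then show ?thesis using that by (auto simp: below_sets_def dest: spec[of _ 0])
  qed
  then have A: "coeff (fps_nth A m) i = 0" if "m * b \<le> i" "m \<noteq> 0" for m i
    unfolding A_def fps_nth_Abs_fps using that by (intro coeff_monom_sum_eq_0) fastforce
  \<comment> \<open>The constant term 1 of \<open>A\<close> lies on the boundary degree, so only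
    this weaker bound covers \<open>m = 0\<close>. In \<open>A * B\<close> the strict bound on
    \<open>B\<close> compensates; in \<open>theta A\<close> the factor \<open>n\<close> removes that
    term.\<close>
  have A': "coeff (fps_nth A m) i = 0" if "m * b < i" for m i
    using A[of m i] that A0 by (cases "m = 0") (auto simp: coeff_1)
  have B: "coeff (fps_nth B m) i = 0" if "m * b \<le> i" for m i
    unfolding B_def fps_nth_Abs_fps using that by (intro coeff_monom_sum_eq_0) fastforce
  have D: "coeff (fps_nth (theta A - A * B) n) i = 0" if i: "n * b \<le> i" for n i
  proof -
    have "coeff (fps_nth A j * fps_nth B (n - j)) i = 0" if j: "j \<le> n" for j
    proof -
      have "n * b = j * b + (n - j) * b" using j by (simp flip: add_mult_distrib)
      then have "j * b < l \<or> (n - j) * b \<le> i - l" if "l \<le> i" for l using i that by linarith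
      then have "coeff (fps_nth A j) l * coeff (fps_nth B (n - j)) (i - l) = 0" if "l \<le> i" for l
        using A' B that by (metis mult_zero_left mult_zero_right)
      then show ?thesis unfolding coeff_mult by (intro sum.neutral) simp
    qed
    then have "coeff (fps_nth (A * B) n) i = 0"
      by (simp only: fps_mult_nth coeff_sum) simp
    moreover have "coeff (of_nat n * fps_nth A n) i = 0"
      using A[OF i] by (cases "n = 0") (auto simp: of_nat_poly)
    ultimately show ?thesis by (simp only: fps_sub_nth theta_nth coeff_diff)
  qed
  have cardN: "m * b \<le> card Y" if "Y \<in> above_sets b c m" for Y m
  proof -
    have "Y \<inter> {..m * c} = Y" using that by (auto simp: above_sets_def)
    then show ?thesis using that by (auto simp: above_sets_def)
  qed
  then have N: "coeff (fps_nth N m) i = 0" if "i < m * b" for m i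
    unfolding N_def fps_nth_Abs_fps using that by (intro coeff_monom_sum_eq_0) fastforce
  have TB: "coeff (fps_nth (T - 1 - B) m) i = 0" if i: "i < m * b" for m i
  proof -
    \<comment> \<open>So the subtracted series 1 contributes nothing to the coefficient
      considered.\<close>
    have "m \<noteq> 0" using i by (cases m) auto
    moreover have "fps_nth T m - fps_nth B m =
        monom_sum (Pow {1..m * c} - {X. X \<subseteq> {1..m * c} \<and> card X < m * b})"
      unfolding T_def B_def fps_nth_Abs_fps monom_sum_def by (intro sum_diff[symmetric]) auto
    moreover have "coeff (monom_sum (Pow {1..m * c} - {X. X \<subseteq> {1..m * c} \<and> card X < m * b})) i = 0"
      using i by (intro coeff_monom_sum_eq_0) auto
    ultimately show ?thesis by simp
  qed
  have E: "coeff (fps_nth (N * (T - 1 - B) - theta N) n) i = 0" if i: "i < n * b" for n i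
  proof -
    have "coeff (fps_nth N j * fps_nth (T - 1 - B) (n - j)) i = 0" if j: "j \<le> n" for j
    proof -
      have "n * b = j * b + (n - j) * b" using j by (simp flip: add_mult_distrib)
      then have "l < j * b \<or> i - l < (n - j) * b" if "l \<le> i" for l using i that by linarith
      then have "coeff (fps_nth N j) l * coeff (fps_nth (T - 1 - B) (n - j)) (i - l) = 0" if "l \<le> i" for l
        using N TB that by (metis mult_zero_left mult_zero_right)
      then show ?thesis unfolding coeff_mult by (intro sum.neutral) simp
    qed
    then have "coeff (fps_nth (N * (T - 1 - B)) n) i = 0"
      by (simp only: fps_mult_nth coeff_sum) simp
    moreover have "coeff (of_nat n * fps_nth N n) i = 0"
      using N[OF i] by (auto simp: of_nat_poly)
    ultimately show ?thesis by (simp only: fps_sub_nth theta_nth coeff_diff)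
  qed
  have "theta A - A * B = 0"
    by (rule disjoint_supports_zero[OF eq A0 N0 D E])
  then show ?thesis by simp
qed

theorem corollary4p16:
  fixes a b n :: nat
  assumes "a \<ge> 1" "b \<ge> 1" "n \<ge> 1"
  shows "whitney_poly (catalan a b n) =
    (\<Sum>\<mu>\<in>partitions n.
       smult (1 / of_nat (z_number \<mu>)) (\<Prod>m\<in>#\<mu>. whitney_poly (uniform_ab a b m)))"
proof (rule partition_sum_unique)
  define A where "A = Abs_fps (\<lambda>k. monom_sum (below_sets b (a + b) k))"
  define B where "B = Abs_fps (\<lambda>m. monom_sum {X. X \<subseteq> {1..m * (a + b)} \<and> card X < m * b})"
  define G where "G = Abs_fps (\<lambda>k. monom (1::rat) (k * b))"
  define W where "W = Abs_fps (\<lambda>n. whitney_poly (catalan a b n))"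
  have W: "W = A * G"
    by (rule fps_ext)
      (simp add: W_def A_def G_def fps_mult_nth whitney_poly_catalan monom_sum_def atLeast0AtMost)
  \<comment> \<open>At \<open>m = 0\<close> the series \<open>B\<close> contributes 0 and the 1 of
    \<open>G\<close> is cancelled, so the sum in the recursion starts at
    \<open>m = 1\<close>.\<close>
  have U: "fps_nth (B + G - 1) m = (if m = 0 then 0 else whitney_poly (uniform_ab a b m))" for m
    by (auto simp: B_def G_def monom_sum_def uniform_ab_def whitney_poly_uniform)
  \<comment> \<open>The geometric series identity again, now for the ratio
    \<open>x^b z\<close>.\<close>
  have theta_G: "theta G = G * (G - 1)"
  proof (rule fps_ext)
    fix n
    have "fps_nth (G * G) n = of_nat (Suc n) * fps_nth G n"
      by (simp add: G_def fps_mult_nth mult_monom flip: add_mult_distrib)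
    then show "fps_nth (theta G) n = fps_nth (G * (G - 1)) n"
      by (simp add: theta_nth algebra_simps)
  qed
  have theta_A: "theta A = A * B" unfolding A_def B_def by (rule below_sets_recursion)
  \<comment> \<open>Logarithmic derivatives add: \<open>B\<close> comes from \<open>A\<close> and
    \<open>G - 1\<close> from \<open>G\<close>.\<close>
  have theta_W: "theta W = (B + G - 1) * W"
    unfolding W theta_mult theta_A theta_G by (simp add: algebra_simps)
  show "of_nat n * whitney_poly (catalan a b n) =
      (\<Sum>m\<in>{1..n}. whitney_poly (uniform_ab a b m) * whitney_poly (catalan a b (n - m)))" for n
  proof -
    have "of_nat n * whitney_poly (catalan a b n) = fps_nth ((B + G - 1) * W) n"
      unfolding theta_W[symmetric] theta_nth by (simp add: W_def)
    also have "\<dots> = (\<Sum>m=0..n. if m = 0 then 0 else whitney_poly (uniform_ab a b m) * whitney_poly (catalan a b (n - m)))"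
      unfolding fps_mult_nth U by (intro sum.cong) (auto simp: W_def)
    also have "\<dots> = (\<Sum>m\<in>{1..n}. whitney_poly (uniform_ab a b m) * whitney_poly (catalan a b (n - m)))"
      by (rule sum.mono_neutral_cong_right) auto
    finally show ?thesis .
  qed
  have "below_sets b (a + b) 0 = {{}}" by (auto simp: below_sets_def)
  then show "whitney_poly (catalan a b 0) = 1" by (simp add: whitney_poly_catalan)
qed

end
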